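(* There exists a dense subgroup $G$ of the additive group $\mathbb{R}^2$ such that for every line $L$ in the plane (not necessarily through the origin), $G\cap L$ is discrete.
   Context: "Discrete" means discrete as a subspace of $\mathbb{R}^2$ with the Euclidean topology; "dense" means dense in $\mathbb{R}^2$. *)

theory Defs
  imports "HOL-Analysis.Analysis" "HOL-Algebra.Group"
begin

definition plane_group :: "(real ^ 2) monoid"
  where "plane_group = \<lparr>carrier = UNIV, monoid.mult = (+), one = 0\<rparr>"

lemma comm_group_plane_group: "comm_group plane_group"
  unfolding plane_group_def
  by (rule comm_groupI) (auto simp: algebra_simps intro: exI[of _ "- x" for x])

definition is_line :: "(real ^ 2) set \<Rightarrow> bool"
  where "is_line L \<longleftrightarrow> affine L \<and> aff_dim L = 1"

end

theory Submission
  imports Defs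
begin

text \<open>
  Take the group generated by the standard basis and a vector \<open>(a, b)\<close> with \<open>1, a, b\<close> linearly
  independent over the rationals; it is dense by Kronecker's theorem. If two of its elements are
  parallel, the vanishing determinant is an integer relation between \<open>1, a, b\<close>, so their integer
  coordinate vectors are parallel as well. Hence the elements of the group on a line through the
  origin are rational multiples, with bounded denominator, of a single one of them.
\<close>

text \<open>If \<open>q\<close> were nonzero, the prime \<open>l\<close> would divide the left side
  to an even power and the right side to an odd one. This replaces separate irrationality proofs for
  the square roots of 2, 3 and 6.\<close>

lemma int_square_eq_mult_square:
  fixes d p q :: int
  assumes "prime l" "odd (multiplicity l d)" "p\<^sup>2 = d * q\<^sup>2"
  shows "q = 0"
proof (rule ccontr)
  assume "q \<noteq> 0"
  moreover have "d \<noteq> 0"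
    using assms(2) by auto
  ultimately have "p \<noteq> 0"
    using assms(3) by auto
  have l: "prime_elem l"
    using assms(1) by auto
  have "2 * multiplicity l p = multiplicity l d + 2 * multiplicity l q"
    using arg_cong[OF assms(3), of "multiplicity l"] l \<open>p \<noteq> 0\<close> \<open>q \<noteq> 0\<close> \<open>d \<noteq> 0\<close>
    by (simp add: prime_elem_multiplicity_mult_distrib prime_elem_multiplicity_power_distrib)
  with assms(2) show False
    by presburger
qed

text \<open>This makes (sqrt 2, sqrt 3) an admissible choice for the vector (a, b). Isolating
  \<open>p\<close> and squaring leaves sqrt 6 as the only surd, so its irrationality forces
  \<open>q * r = 0\<close>; the irrationality of sqrt 2 or sqrt 3 settles what remains.\<close>

lemma sqrt_2_3_int_independent:
  fixes p q r :: int
  assumes "of_int p + of_int q * sqrt 2 + of_int r * sqrt 3 = 0"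
  shows "p = 0 \<and> q = 0 \<and> r = 0"
proof -
  have m2: "multiplicity 2 (2::int) = 1" and m3: "multiplicity 3 (3::int) = 1"
    by (simp_all add: multiplicity_self)
  have "multiplicity 2 (3::int) = 0"
    by (simp add: not_dvd_imp_multiplicity_0)
  then have m6: "multiplicity 2 (6::int) = 1"
    using prime_elem_multiplicity_mult_distrib[of "2::int" 2 3] m2 by simp
  have "(of_int q * sqrt 2 + of_int r * sqrt 3)\<^sup>2 = (of_int p :: real)\<^sup>2"
    using assms by (simp add: power2_eq_iff eq_neg_iff_add_eq_0 algebra_simps)
  then have "2 * of_int q * of_int r * sqrt 6 = of_int (p\<^sup>2 - 2 * q\<^sup>2 - 3 * r\<^sup>2)"
    by (simp add: power2_sum power_mult_distrib real_sqrt_mult[symmetric] algebra_simps)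
  \<comment> \<open>A second squaring removes sqrt 6 and gives an equation between integers, with
    \<open>d = 6\<close> and \<open>l = 2\<close>.\<close>
  then have "(2 * of_int q * of_int r * sqrt 6)\<^sup>2 = (of_int (p\<^sup>2 - 2 * q\<^sup>2 - 3 * r\<^sup>2))\<^sup>2"
    by simp
  then have "of_int (6 * (2 * q * r)\<^sup>2) = (of_int ((p\<^sup>2 - 2 * q\<^sup>2 - 3 * r\<^sup>2)\<^sup>2) :: real)"
    by (simp add: power_mult_distrib)
  then have "2 * q * r = 0"
    using int_square_eq_mult_square[of 2 6 "p\<^sup>2 - 2 * q\<^sup>2 - 3 * r\<^sup>2" "2 * q * r"] m6
    unfolding of_int_eq_iff by simp
  then consider "q = 0" | "r = 0"
    by auto
  then show ?thesis
  proof cases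
    case 1
    then have "(of_int p)\<^sup>2 = (of_int r * sqrt 3)\<^sup>2"
      using assms by (simp add: power2_eq_iff eq_neg_iff_add_eq_0)
    then have "of_int (p\<^sup>2) = (of_int (3 * r\<^sup>2) :: real)"
      by (simp add: power_mult_distrib)
    then have "r = 0"
      using int_square_eq_mult_square[of 3 3 p r] m3 unfolding of_int_eq_iff by simp
    with 1 assms show ?thesis by simp
  next
    case 2
    then have "(of_int p)\<^sup>2 = (of_int q * sqrt 2)\<^sup>2"
      using assms by (simp add: power2_eq_iff eq_neg_iff_add_eq_0)
    then have "of_int (p\<^sup>2) = (of_int (2 * q\<^sup>2) :: real)"
      by (simp add: power_mult_distrib)
    then have "q = 0"
      using int_square_eq_mult_square[of 2 2 p q] m2 unfolding of_int_eq_iff by simp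
    with 2 assms show ?thesis by simp
  qed
qed

definition lattice_vector :: "int \<Rightarrow> int \<Rightarrow> int \<Rightarrow> real ^ 2"
  where "lattice_vector m n k = vector [of_int m + of_int k * sqrt 2, of_int n + of_int k * sqrt 3]"

definition lattice_group :: "(real ^ 2) set"
  where "lattice_group = {lattice_vector m n k |m n k. True}"

lemma lattice_vector_nth [simp]:
  "lattice_vector m n k $ 1 = of_int m + of_int k * sqrt 2"
  "lattice_vector m n k $ 2 = of_int n + of_int k * sqrt 3"
  by (simp_all add: lattice_vector_def)

lemma lattice_vector_add:
  "lattice_vector m n k + lattice_vector m' n' k' = lattice_vector (m + m') (n + n') (k + k')"
  by (simp add: vec_eq_iff forall_2 algebra_simps)

lemma lattice_vector_diff:
  "lattice_vector m n k - lattice_vector m' n' k' = lattice_vector (m - m') (n - n') (k - k')"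
  by (simp add: vec_eq_iff forall_2 algebra_simps)

lemma lattice_vector_0: "lattice_vector 0 0 0 = 0"
  by (simp add: vec_eq_iff forall_2)

lemma lattice_group_add:
  assumes "x \<in> lattice_group" "y \<in> lattice_group"
  shows "x + y \<in> lattice_group"
  using assms by (fastforce simp: lattice_group_def lattice_vector_add)

lemma lattice_group_diff:
  assumes "x \<in> lattice_group" "y \<in> lattice_group"
  shows "x - y \<in> lattice_group"
  using assms by (fastforce simp: lattice_group_def lattice_vector_diff)

lemma subgroup_lattice_group: "subgroup lattice_group plane_group"
proof -
  interpret comm_group plane_group by (rule comm_group_plane_group)
  have inv: "inv\<^bsub>plane_group\<^esub> x = - x" for x
    by (rule inv_equality) (simp_all add: plane_group_def)
  have zero: "0 \<in> lattice_group"
    using lattice_vector_0[symmetric] by (auto simp: lattice_group_def)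
  show ?thesis
  proof
    show "\<one>\<^bsub>plane_group\<^esub> \<in> lattice_group"
      using zero by (simp add: plane_group_def)
    fix x assume "x \<in> lattice_group"
    then show "inv\<^bsub>plane_group\<^esub> x \<in> lattice_group"
      using lattice_group_diff[OF zero] by (simp add: inv)
  qed (auto simp: plane_group_def intro: lattice_group_add)
qed

lemma parallel_lattice_vectors:
  assumes "lattice_vector m n k = t *\<^sub>R lattice_vector m' n' k'" "lattice_vector m' n' k' \<noteq> 0"
  shows "of_int m = t * of_int m'" "of_int n = t * of_int n'" "of_int k = t * of_int k'"
proof -
  have 1: "of_int m + of_int k * sqrt 2 = t * (of_int m' + of_int k' * sqrt 2)"
   and 2: "of_int n + of_int k * sqrt 3 = t * (of_int n' + of_int k' * sqrt 3)"
    using arg_cong[OF assms(1), of "\<lambda>v. v $ 1"] arg_cong[OF assms(1), of "\<lambda>v. v $ 2"] by simp_all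
  \<comment> \<open>The determinant of the two parallel vectors vanishes. On expansion the terms in
    sqrt 6 cancel, and the coefficients of 1, sqrt 2 and sqrt 3 are, up to sign, the 2x2 minors of
    the integer coordinates.\<close>
  have "(of_int m + of_int k * sqrt 2) * (of_int n' + of_int k' * sqrt 3)
      = (of_int m' + of_int k' * sqrt 2) * (of_int n + of_int k * sqrt 3)"
    unfolding 1 2 by simp
  then have "of_int (m * n' - m' * n) + of_int (k * n' - k' * n) * sqrt 2
      + of_int (m * k' - m' * k) * sqrt 3 = 0"
    by (simp add: algebra_simps)
  from sqrt_2_3_int_independent[OF this]
  have det: "m * n' = m' * n" "k * n' = k' * n" "m * k' = m' * k"
    by auto
  note rdet = det[THEN arg_cong[where f = real_of_int], unfolded of_int_mult]
  define a b where "a = of_int m' + of_int k' * sqrt 2" and "b = of_int n' + of_int k' * sqrt 3"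
  have nz: "a \<noteq> 0 \<or> b \<noteq> 0"
    using assms(2) by (auto simp: vec_eq_iff forall_2 a_def b_def)
  \<comment> \<open>The minors show that the coordinate vectors are parallel; cancelling a nonzero
    entry \<open>a\<close> or \<open>b\<close> identifies the factor as the same
    \<open>t\<close>.\<close>
  have scale: "x = t * x'"
    if "a * x = x' * (of_int m + of_int k * sqrt 2)" "b * x = x' * (of_int n + of_int k * sqrt 3)"
    for x x' :: real
    using that nz unfolding 1 2 a_def[symmetric] b_def[symmetric] by auto
  show "of_int m = t * of_int m'" "of_int n = t * of_int n'" "of_int k = t * of_int k'"
    using rdet by (auto intro!: scale simp: a_def b_def algebra_simps)
qed

text \<open>Take \<open>N\<close> to be the l1 norm of the integer coordinates of \<open>v\<close>,
  not of \<open>v\<close> in the plane. Scaling by \<open>t\<close> turns it into \<bar>t\<bar>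
  \<open>* N\<close>, which is again an integer, and a positive one for nonzero
  \<open>t\<close>.\<close>

lemma scaleR_lattice_vector_bound:
  assumes "v \<in> lattice_group" "v \<noteq> 0"
  obtains N where "N > 0" "\<And>t. t *\<^sub>R v \<in> lattice_group \<Longrightarrow> t \<noteq> 0 \<Longrightarrow> 1 \<le> \<bar>t\<bar> * N"
proof -
  obtain m n k where v: "v = lattice_vector m n k"
    using assms(1) by (auto simp: lattice_group_def)
  define N where "N = \<bar>m\<bar> + \<bar>n\<bar> + \<bar>k\<bar>"
  have nz: "N > 0"
    using assms(2) lattice_vector_0 unfolding v N_def by (cases "m = 0"; cases "n = 0"; cases "k = 0") auto
  show thesis
  proof
    show "real_of_int N > 0" using nz by simp
    fix t assume t: "t *\<^sub>R v \<in> lattice_group" "t \<noteq> 0"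
    then obtain m' n' k' where eq: "lattice_vector m' n' k' = t *\<^sub>R lattice_vector m n k"
      unfolding v lattice_group_def by auto
    have "of_int (\<bar>m'\<bar> + \<bar>n'\<bar> + \<bar>k'\<bar>) = \<bar>t\<bar> * of_int N"
      using parallel_lattice_vectors[OF eq] assms(2) by (simp add: v N_def abs_mult algebra_simps)
    moreover from this have "of_int (\<bar>m'\<bar> + \<bar>n'\<bar> + \<bar>k'\<bar>) > (0 :: real)"
      using t(2) nz by simp
    then have "of_int (\<bar>m'\<bar> + \<bar>n'\<bar> + \<bar>k'\<bar>) \<ge> (1 :: real)"
      unfolding of_int_0_less_iff of_int_1_le_iff by simp
    ultimately show "1 \<le> \<bar>t\<bar> * of_int N" by simp
  qed
qed

lemma discrete_lattice_group_Int_collinear: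
  assumes "collinear L"
  shows "discrete (lattice_group \<inter> L)"
proof (cases "\<exists>x\<in>lattice_group \<inter> L. \<exists>y\<in>lattice_group \<inter> L. x \<noteq> y")
  case False
  then show ?thesis
    by (auto simp: discrete_def isolated_in_dist_Ex_iff intro: exI[of _ 1])
next
  case True
  then obtain x y where x: "x \<in> lattice_group \<inter> L" and y: "y \<in> lattice_group \<inter> L" and "x \<noteq> y"
    by blast
  obtain u where u: "\<And>x y. x \<in> L \<Longrightarrow> y \<in> L \<Longrightarrow> \<exists>c. x - y = c *\<^sub>R u"
    using assms unfolding collinear_def by blast
  obtain c where c: "x - y = c *\<^sub>R u" using u x y by blast
  with \<open>x \<noteq> y\<close> have "c \<noteq> 0" by auto
  obtain N where N: "N > 0"
    "\<And>t. t *\<^sub>R (x - y) \<in> lattice_group \<Longrightarrow> t \<noteq> 0 \<Longrightarrow> 1 \<le> \<bar>t\<bar> * N"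
    using scaleR_lattice_vector_bound[of "x - y"] lattice_group_diff x y \<open>x \<noteq> y\<close> by auto
  \<comment> \<open>Only differences of points of \<open>L\<close> enter, and these stay in the
    group, so \<open>L\<close> may miss the origin. Each difference of distinct points is a multiple
    of \<open>x - y\<close> by a factor of absolute value at least \<open>1 / N\<close>, hence the
    uniform gap.\<close>
  show ?thesis
  proof (rule uniform_discrete_imp_discrete, rule uniformI2)
    show "norm (x - y) / N > 0" using N(1) \<open>x \<noteq> y\<close> by simp
    fix z w assume z: "z \<in> lattice_group \<inter> L" and w: "w \<in> lattice_group \<inter> L" and "z \<noteq> w"
    obtain d where "z - w = d *\<^sub>R u" using u z w by blast
    then have t: "z - w = (d / c) *\<^sub>R (x - y)" using c \<open>c \<noteq> 0\<close> by simp
    moreover from t have "(d / c) *\<^sub>R (x - y) \<in> lattice_group"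
      using lattice_group_diff[of z w] z w by simp
    moreover have "d / c \<noteq> 0" using t \<open>z \<noteq> w\<close> by auto
    ultimately have "1 \<le> \<bar>d / c\<bar> * N" using N(2) by blast
    then have "1 * norm (x - y) \<le> \<bar>d / c\<bar> * N * norm (x - y)"
      by (rule mult_right_mono) simp
    then show "norm (x - y) / N \<le> dist z w"
      using N(1) unfolding dist_norm t norm_scaleR by (simp add: field_simps)
  qed
qed

lemma closure_lattice_group: "closure lattice_group = UNIV"
proof -
  \<comment> \<open>Kronecker's theorem is applied in dimension 2 to sqrt 2 and sqrt 3; the extra
    entry 1 at index 2 belongs to its independence hypothesis.\<close>
  define \<theta> :: "nat \<Rightarrow> real" where "\<theta> = (\<lambda>i. if i = 0 then sqrt 2 else if i = 1 then sqrt 3 else 1)"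
  \<comment> \<open>The reals as a module over the integers, so that \<open>independent\<close>
    means the absence of integer relations.\<close>
  interpret Modules.module "\<lambda>r x. real_of_int r * x"
    by (simp add: Modules.module.intro distrib_left mult.commute)
  have img: "{..2::nat} = {0, 1, 2}" by auto
  have ind: "independent (\<theta> ` {..2})"
  proof
    assume "dependent (\<theta> ` {..2})"
    then obtain c where c: "\<exists>v\<in>\<theta> ` {..2}. c v \<noteq> 0" "(\<Sum>v\<in>\<theta> ` {..2}. of_int (c v) * v) = 0"
      by (auto simp: dependent_finite)
    have "of_int (c 1) + of_int (c (sqrt 2)) * sqrt 2 + of_int (c (sqrt 3)) * sqrt 3 = 0"
      using c(2) by (simp add: img \<theta>_def)
    with c(1) show False
      by (auto simp: img \<theta>_def dest: sqrt_2_3_int_independent)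
  qed
  have inj: "inj_on \<theta> {..2}" by (auto simp: img \<theta>_def)
  have "\<exists>y\<in>lattice_group. dist y x < e" if "e > 0" for x :: "real ^ 2" and e
  proof -
    \<comment> \<open>Each coordinate gets half of \<open>e\<close>, because the norm is bounded by
      the sum of the two absolute values.\<close>
    have "e / 2 > 0" using that by simp
    from Kronecker_thm_2[OF ind inj _ this, of "\<lambda>i. if i = 0 then x $ 1 else x $ 2"]
    obtain k m where km: "\<And>i. i < 2 \<Longrightarrow>
        \<bar>of_int k * \<theta> i - of_int (m i) - (if i = 0 then x $ 1 else x $ 2)\<bar> < e / 2"
      by (auto simp: \<theta>_def)
    \<comment> \<open>The signs are negative because Kronecker's theorem subtracts the integers
      \<open>m i\<close>.\<close>
    define y where "y = lattice_vector (- m 0) (- m 1) k"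
    have "\<bar>(y - x) $ 1\<bar> < e / 2" "\<bar>(y - x) $ 2\<bar> < e / 2"
      using km[of 0] km[of 1] by (simp_all add: y_def \<theta>_def algebra_simps)
    moreover have "norm (y - x) \<le> \<bar>(y - x) $ 1\<bar> + \<bar>(y - x) $ 2\<bar>"
      using norm_le_l1_cart[of "y - x"] by (simp add: sum_2)
    ultimately have "dist y x < e" unfolding dist_norm by linarith
    then show ?thesis unfolding y_def lattice_group_def by blast
  qed
  then show ?thesis by (auto simp: closure_approachable)
qed

theorem theorem6:
  shows "\<exists>G :: (real ^ 2) set. subgroup G plane_group \<and> closure G = UNIV \<and>
    (\<forall>L. is_line L \<longrightarrow> discrete (G \<inter> L))"
  using subgroup_lattice_group closure_lattice_group discrete_lattice_group_Int_collinear
  by (auto simp: is_line_def collinear_aff_dim intro!: exI[of _ lattice_group])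

end
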